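(* Let $(X,\mathcal{B})$ be a bornological universe whose underlying topological space $X$ is normal and Hausdorff. Then $(X,\mathcal{B})$ is realcompact if and only if each $z$-ultrafilter on $X$ that does not contain a decreasing, unbounded sequence of zero-sets is fixed.
   Context: A bornology on a set $X$ is a set $\mathcal{B}\subseteq 2^X$ such that $\{x\}\in\mathcal{B}$ for each $x\in X$; $B\in\mathcal{B}$ and $A\subseteq B$ imply $A\in\mathcal{B}$; and $A\cup B\in\mathcal{B}$ whenever $A,B\in\mathcal{B}$. A bornological universe $(X,\mathcal{B})$ is a topological space $X$ endowed with a bornology $\mathcal{B}$ on its underlying set. $\mathcal{C}_{\mathcal{B}}(X)$ is the set of all continuous real valued maps on $X$ that are bounded on every element of $\mathcal{B}$. For $X$ Tychonoff (completely regular and Hausdorff) and a continuous $f:X\to\mathbb{R}$, $f^{\beta}$ denotes the unique continuous map from the Stone–Čech compactification $\beta(X)$ to the one-point compactification $\mathbb{R}\cup\{\infty\}$ whose restriction to $X$ is $f$. Put $\upsilon_{\mathcal{B}}(X)=\{x\in\beta(X)\mid \forall f\in\mathcal{C}_{\mathcal{B}}(X): f^{\beta}(x)\neq\infty\}$, a subspace of $\beta(X)$ containing $X$. $(X,\mathcal{B})$ is realcompact if $\upsilon_{\mathcal{B}}(X)=X$. A zero-set of $X$ is a set $f^{-1}(0)$ with $f:X\to\mathbb{R}$ continuous. A $z$-filter is a filter in the lattice of zero-sets not containing $\emptyset$; a $z$-ultrafilter is a maximal $z$-filter; it is fixed if the intersection of all its elements is non-empty. A decreasing sequence $(Z_n)_n$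 of zero-sets is unbounded if for each $B\in\mathcal{B}$ there is an $n\in\mathbb{N}$ with $\overline{B}\cap Z_n=\emptyset$. A $z$-ultrafilter contains a sequence $(Z_n)_n$ if it contains every $Z_n$. *)

theory Defs
  imports "HOL-Analysis.Analysis"
begin

definition bornology_on :: "'a set \<Rightarrow> 'a set set \<Rightarrow> bool" where
  "bornology_on S \<B> \<longleftrightarrow>
     \<B> \<subseteq> Pow S \<and>
     (\<forall>x\<in>S. {x} \<in> \<B>) \<and>
     (\<forall>A B. B \<in> \<B> \<longrightarrow> A \<subseteq> B \<longrightarrow> A \<in> \<B>) \<and>
     (\<forall>A\<in>\<B>. \<forall>B\<in>\<B>. A \<union> B \<in> \<B>)"

definition bornological_universe :: "'a topology \<Rightarrow> 'a set set \<Rightarrow> bool" where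
  "bornological_universe X \<B> \<longleftrightarrow> bornology_on (topspace X) \<B>"

(* Functions are total here; values outside topspace X are irrelevant, since every
   member of the bornology is a subset of topspace X. *)
definition bdd_cont :: "'a topology \<Rightarrow> 'a set set \<Rightarrow> ('a \<Rightarrow> real) set" where
  "bdd_cont X \<B> = {f. continuous_map X euclideanreal f \<and> (\<forall>B\<in>\<B>. bounded (f ` B))}"

text \<open>
  The Stone-Cech compactification is the closure of the image of \<open>X\<close> under the evaluation map
  into the cube indexed by the continuous functions from \<open>X\<close> to the closed unit interval.
  These functions are taken extensional, so that each of them is counted exactly once.
  For Tychonoff \<open>X\<close>, evaluation is an embedding, and \<open>X\<close> is identified with its image.
\<close>

definition unit_maps :: "'a topology \<Rightarrow> ('a \<Rightarrow> real) set" where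
  "unit_maps X = {h \<in> extensional (topspace X). continuous_map X (top_of_set {0..1}) h}"

definition sc_embed :: "'a topology \<Rightarrow> 'a \<Rightarrow> ('a \<Rightarrow> real) \<Rightarrow> real" where
  "sc_embed X x = (\<lambda>h\<in>unit_maps X. h x)"

definition unit_cube :: "'a topology \<Rightarrow> (('a \<Rightarrow> real) \<Rightarrow> real) topology" where
  "unit_cube X = product_topology (\<lambda>_. top_of_set {0..1}) (unit_maps X)"

definition stone_cech :: "'a topology \<Rightarrow> (('a \<Rightarrow> real) \<Rightarrow> real) topology" where
  "stone_cech X =
     subtopology (unit_cube X) (unit_cube X closure_of (sc_embed X ` topspace X))"

text \<open>
  The extension of a continuous real function to the Stone-Cech compactification. It takes
  values in the one-point compactification of the reals, whose point at infinity is
  \<^term>\<open>None\<close>. Being extensional makes it unique as a total function.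
\<close>

definition is_sc_ext ::
    "'a topology \<Rightarrow> ('a \<Rightarrow> real) \<Rightarrow> ((('a \<Rightarrow> real) \<Rightarrow> real) \<Rightarrow> real option) \<Rightarrow> bool" where
  "is_sc_ext X f g \<longleftrightarrow>
     g \<in> extensional (topspace (stone_cech X)) \<and>
     continuous_map (stone_cech X) (Alexandroff_compactification euclideanreal) g \<and>
     (\<forall>x\<in>topspace X. g (sc_embed X x) = Some (f x))"

definition sc_ext ::
    "'a topology \<Rightarrow> ('a \<Rightarrow> real) \<Rightarrow> (('a \<Rightarrow> real) \<Rightarrow> real) \<Rightarrow> real option" where
  "sc_ext X f = (THE g. is_sc_ext X f g)"

lemma topspace_stone_cech:
  "topspace (stone_cech X) = unit_cube X closure_of (sc_embed X ` topspace X)"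
  by (simp add: stone_cech_def closure_of_subset_topspace inf.absorb2)

lemma sc_embed_in_cube: "sc_embed X ` topspace X \<subseteq> topspace (unit_cube X)"
proof (rule image_subsetI)
  fix x assume x: "x \<in> topspace X"
  have "h x \<in> {0..1}" if "h \<in> unit_maps X" for h
    using that x continuous_map_image_subset_topspace[of X "top_of_set {0..1}" h]
    by (auto simp: unit_maps_def)
  then show "sc_embed X x \<in> topspace (unit_cube X)"
    by (simp add: unit_cube_def sc_embed_def)
qed

lemma compact_Hausdorff_stone_cech: "compact_space (stone_cech X)" "Hausdorff_space (stone_cech X)"
proof -
  have "compact_space (top_of_set {0..1::real})"
    by (rule compact_space_subtopology) simp
  then have "compact_space (unit_cube X)"
    unfolding unit_cube_def compact_space_product_topology by blast
  then show "compact_space (stone_cech X)"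
    unfolding stone_cech_def
    by (metis closedin_closure_of closedin_compact_space compact_space_subtopology)
  show "Hausdorff_space (stone_cech X)"
    unfolding stone_cech_def unit_cube_def
    by (intro Hausdorff_space_subtopology)
       (simp add: Hausdorff_space_product_topology Hausdorff_space_subtopology Hausdorff_space_euclidean)
qed

lemma ex1_sc_ext:
  assumes f: "continuous_map X euclideanreal f"
  shows "\<exists>!g. is_sc_ext X f g"
proof (rule ex_ex1I)
  define K where "K = Alexandroff_compactification euclideanreal"
  have CK: "compact_space K"
    unfolding K_def by (rule compact_space_Alexandroff_compactification)
  have HK: "Hausdorff_space K"
    unfolding K_def Hausdorff_space_Alexandroff_compactification
    using Hausdorff_space_euclidean locally_compact_space_euclidean by blast
  have RK: "completely_regular_space K"
    by (simp add: CK HK compact_Hausdorff_or_regular_imp_normal_space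
        normal_imp_completely_regular_space)
  have fK: "continuous_map X K (Some \<circ> f)"
    using continuous_map_compose[OF f continuous_map_Some] by (simp add: K_def)
  define E where "E = sc_embed X ` topspace X"
  have clE: "E \<subseteq> topspace (stone_cech X)"
    using closure_of_subset[OF sc_embed_in_cube] by (simp add: E_def topspace_stone_cech)
  show "\<exists>g. is_sc_ext X f g"
  proof -
    obtain I :: "(real option \<Rightarrow> real) set" where emb: "embedding_map K (product_topology (\<lambda>h. top_of_set {0..1}) I) (\<lambda>x. \<lambda>h\<in>I. h x)"
      using completely_regular_space_cube_embedding_explicit[OF RK HK] by blast
    define P where "P = product_topology (\<lambda>h. top_of_set {0..1::real}) I"
    define e where "e = (\<lambda>x. \<lambda>h\<in>I. h x :: real)"
    have emb: "embedding_map K P e" using emb by (simp add: P_def e_def)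
    have HP: "Hausdorff_space P" 
      by (simp add: P_def Hausdorff_space_product_topology Hausdorff_space_subtopology Hausdorff_space_euclidean)
    have conte: "continuous_map K P e" using emb homeomorphic_imp_continuous_map continuous_map_into_fulltopology
      unfolding embedding_map_def by blast
    have conth: "continuous_map K (top_of_set {0..1}) h" if "h \<in> I" for h
    proof -
      have "continuous_map K (top_of_set {0..1}) (\<lambda>x. e x h)"
        using conte that by (simp add: P_def continuous_map_componentwise)
      then show ?thesis using that by (simp add: e_def)
    qed
    define \<phi> where "\<phi> h = restrict (h \<circ> (Some \<circ> f)) (topspace X)" for h :: "real option \<Rightarrow> real"
    have \<phi>: "\<phi> h \<in> unit_maps X" if "h \<in> I" for h
      using continuous_map_compose[OF fK conth[OF that]] by (auto simp: \<phi>_def unit_maps_def intro: continuous_map_eq)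
    define G where "G p = (\<lambda>h\<in>I. p (\<phi> h) :: real)" for p :: "('a \<Rightarrow> real) \<Rightarrow> real"
    have contG: "continuous_map (unit_cube X) P G"
      unfolding P_def G_def continuous_map_componentwise 
    proof (intro conjI ballI)
      fix h assume "h \<in> I"
      then show "continuous_map (unit_cube X) (top_of_set {0..1}) (\<lambda>x. (\<lambda>h\<in>I. x (\<phi> h)) h)"
        using continuous_map_product_projection[OF \<phi>[OF \<open>h \<in> I\<close>], of "\<lambda>_. top_of_set {0..1::real}"]
        by (simp add: unit_cube_def)
    qed auto
    have GE: "G (sc_embed X x) = e (Some (f x))" if "x \<in> topspace X" for x
      using that \<phi> by (auto simp: G_def e_def sc_embed_def \<phi>_def fun_eq_iff)
    have cle: "closedin P (e ` topspace K)"
      using CK HP conte compactin_imp_closedin image_compactin unfolding compact_space_def by blast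
    have Gin: "G p \<in> e ` topspace K" if "p \<in> topspace (stone_cech X)" for p
    proof -
      have "p \<in> unit_cube X closure_of E" using that by (simp add: topspace_stone_cech E_def)
      then have "G p \<in> P closure_of (G ` E)"
        using continuous_map_image_closure_subset[OF contG, of E] by blast
      moreover have "G ` E \<subseteq> e ` topspace K"
        using GE f by (auto simp: E_def K_def)
      ultimately show ?thesis using closure_of_minimal[OF _ cle, of "G ` E"] by blast
    qed
    obtain e' where e': "homeomorphic_maps K (subtopology P (e ` topspace K)) e e'"
      using emb unfolding embedding_map_def homeomorphic_map_maps by blast
    have contG': "continuous_map (stone_cech X) (subtopology P (e ` topspace K)) G"
      unfolding continuous_map_in_subtopology
    proof
      show "continuous_map (stone_cech X) P G"
        unfolding stone_cech_def using contG by (rule continuous_map_from_subtopology)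
      show "G \<in> topspace (stone_cech X) \<rightarrow> e ` topspace K" using Gin by blast
    qed
    define g where "g = restrict (e' \<circ> G) (topspace (stone_cech X))"
    have "continuous_map (stone_cech X) K g"
      unfolding g_def
    proof (rule continuous_map_eq)
      show "continuous_map (stone_cech X) K (e' \<circ> G)"
        using continuous_map_compose[OF contG', of K e'] e' unfolding homeomorphic_maps_def by blast
    qed simp
    moreover have "g (sc_embed X x) = Some (f x)" if "x \<in> topspace X" for x
    proof -
      have "sc_embed X x \<in> topspace (stone_cech X)" using clE that by (auto simp: E_def)
      moreover have "Some (f x) \<in> topspace K" by (simp add: K_def)
      ultimately show ?thesis using e' GE[OF that] by (simp add: g_def homeomorphic_maps_def)
    qed
    ultimately have "is_sc_ext X f g" by (simp add: is_sc_ext_def K_def g_def)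
    then show ?thesis by blast
  qed
  show "g = g'" if "is_sc_ext X f g" "is_sc_ext X f g'" for g g'
  proof (rule extensionalityI)
    show "g \<in> extensional (topspace (stone_cech X))" "g' \<in> extensional (topspace (stone_cech X))"
      using that by (auto simp: is_sc_ext_def)
    fix p assume p: "p \<in> topspace (stone_cech X)"
    have "p \<in> unit_cube X closure_of E"
      using p unfolding topspace_stone_cech E_def .
    moreover have "E \<subseteq> unit_cube X closure_of E"
      using clE unfolding topspace_stone_cech E_def .
    ultimately have "p \<in> stone_cech X closure_of E"
      unfolding stone_cech_def closure_of_subtopology E_def[symmetric]
      by (simp only: inf.absorb2 Int_iff)
    then show "g p = g' p"
      by (rule forall_in_closure_of_eq[OF _ HK])
         (use that in \<open>auto simp: is_sc_ext_def K_def E_def\<close>)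
  qed
qed

lemma embedding_sc_embed:
  assumes "completely_regular_space X" "Hausdorff_space X"
  shows "embedding_map X (stone_cech X) (sc_embed X)"
proof -
  have "mspace (submetric (cfunspace X euclidean_metric) {f. f \<in> topspace X \<rightarrow> {0..1::real}}) = unit_maps X"
    by (auto simp: unit_maps_def continuous_map_in_subtopology image_subset_iff Pi_iff
        intro: bounded_subset[of "{0..1}"])
  then have "embedding_map X (unit_cube X) (sc_embed X)"
    using completely_regular_space_cube_embedding_explicit[OF assms]
    by (simp add: unit_cube_def sc_embed_def[abs_def])
  then show ?thesis
    using closure_of_subset[OF sc_embed_in_cube, of X]
    by (auto simp: stone_cech_def embedding_map_in_subtopology)
qed

definition upsilon :: "'a topology \<Rightarrow> 'a set set \<Rightarrow> (('a \<Rightarrow> real) \<Rightarrow> real) set" where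
  "upsilon X \<B> = {p \<in> topspace (stone_cech X). \<forall>f\<in>bdd_cont X \<B>. sc_ext X f p \<noteq> None}"

definition realcompact_universe :: "'a topology \<Rightarrow> 'a set set \<Rightarrow> bool" where
  "realcompact_universe X \<B> \<longleftrightarrow> upsilon X \<B> = sc_embed X ` topspace X"

definition zero_set :: "'a topology \<Rightarrow> 'a set \<Rightarrow> bool" where
  "zero_set X Z \<longleftrightarrow> (\<exists>f. continuous_map X euclideanreal f \<and> Z = {x \<in> topspace X. f x = 0})"

(* As usual for filters in a lattice, a z-filter is required to be nonempty. *)
definition z_filter :: "'a topology \<Rightarrow> 'a set set \<Rightarrow> bool" where
  "z_filter X \<F> \<longleftrightarrow>
     \<F> \<subseteq> Collect (zero_set X) \<and> \<F> \<noteq> {} \<and> {} \<notin> \<F> \<and>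
     (\<forall>A\<in>\<F>. \<forall>B\<in>\<F>. A \<inter> B \<in> \<F>) \<and>
     (\<forall>A\<in>\<F>. \<forall>B. zero_set X B \<longrightarrow> A \<subseteq> B \<longrightarrow> B \<in> \<F>)"

definition z_ultrafilter :: "'a topology \<Rightarrow> 'a set set \<Rightarrow> bool" where
  "z_ultrafilter X \<F> \<longleftrightarrow> z_filter X \<F> \<and> (\<forall>\<G>. z_filter X \<G> \<longrightarrow> \<F> \<subseteq> \<G> \<longrightarrow> \<G> = \<F>)"

definition fixed_family :: "'a set set \<Rightarrow> bool" where
  "fixed_family \<F> \<longleftrightarrow> \<Inter>\<F> \<noteq> {}"

definition unbounded_seq :: "'a topology \<Rightarrow> 'a set set \<Rightarrow> (nat \<Rightarrow> 'a set) \<Rightarrow> bool" where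
  "unbounded_seq X \<B> Z \<longleftrightarrow> (\<forall>B\<in>\<B>. \<exists>n. (X closure_of B) \<inter> Z n = {})"

end

theory Submission
  imports Defs
begin

text \<open>
  The points of the remainder \<open>\<beta>(X) - X\<close> are where free \<open>z\<close>-ultrafilters converge, and both
  implications compare, for such a point \<open>p\<close> and such a \<open>z\<close>-ultrafilter \<open>\<F>\<close>, an unbounded
  sequence in \<open>\<F>\<close> with a function \<open>f \<in> C\<^sub>\<B>(X)\<close> such that \<open>f\<^sup>\<beta>(p) = \<infinity>\<close>.

  From functions to sequences there is no obstacle: if \<open>f\<^sup>\<beta>(p) = \<infinity>\<close>, then the zero-sets
  \<open>{x. \<bar>f x\<bar> \<ge> n}\<close> belong to \<open>\<F>\<close>, and they form an unbounded sequence because \<open>f\<close> is bounded on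
  the members of \<open>\<B>\<close>. So if \<open>(X, \<B>)\<close> is realcompact, every free \<open>z\<close>-ultrafilter contains an
  unbounded sequence (\<open>realcompact_imp_unbounded_free\<close>).

  The converse is not a pointwise statement: one \<open>z\<close>-ultrafilter converging to \<open>p\<close> may contain an
  unbounded sequence although \<open>p \<in> \<upsilon>\<^sub>\<B>(X)\<close>. For example, in the plane let \<open>\<B>\<close> consist of
  the sets whose closure misses \<open>[n, \<infinity>) \<times> {0}\<close> for some \<open>n\<close>. Every function in \<open>C\<^sub>\<B>(X)\<close> is then
  bounded, whence \<open>\<upsilon>\<^sub>\<B>(X) = \<beta>(X)\<close>, but the half-lines \<open>[n, \<infinity>) \<times> {0}\<close> are an unbounded
  sequence with the finite intersection property.
  What helps is to use the hypothesis on all \<open>z\<close>-ultrafilters at once. If some continuous \<open>f\<close> were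
  unbounded on some \<open>B \<in> \<B>\<close>, then there would be a \<open>z\<close>-ultrafilter meeting the closure of \<open>B\<close> and
  containing all sets \<open>{x. \<bar>f x\<bar> \<ge> n}\<close>; it is free, but by normality it contains no unbounded
  sequence. Hence the hypothesis forces \<open>C\<^sub>\<B>(X)\<close> to be all of \<open>C(X)\<close>
  (\<open>continuous_imp_bounded_on_bornology\<close>), and there is no constraint left when a function is built
  from a sequence: a decreasing sequence \<open>(Z\<^sub>n)\<close> of zero-sets with empty intersection always admits
  a continuous \<open>f\<close> with \<open>f \<ge> n\<close> on \<open>Z\<^sub>n\<close> (\<open>decseq_zero_sets_imp_unbounded_function\<close>), and
  this function has \<open>f\<^sup>\<beta>(p) = \<infinity>\<close>.
\<close>

section \<open>Zero-sets\<close>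

lemma zero_setI: "continuous_map X euclideanreal f \<Longrightarrow> zero_set X {x \<in> topspace X. f x = 0}"
  by (auto simp: zero_set_def)

lemma zero_set_subset: "zero_set X Z \<Longrightarrow> Z \<subseteq> topspace X"
  by (auto simp: zero_set_def)

lemma zero_set_topspace: "zero_set X (topspace X)"
  using zero_setI[of X "\<lambda>_. 0"] by simp

lemma zero_set_le:
  assumes "continuous_map X euclideanreal f"
  shows "zero_set X {x \<in> topspace X. f x \<le> c}"
proof -
  have "continuous_map X euclideanreal (\<lambda>x. max 0 (f x - c))"
    using assms by (intro continuous_intros) auto
  moreover have "{x \<in> topspace X. f x \<le> c} = {x \<in> topspace X. max 0 (f x - c) = 0}"
    by auto
  ultimately show ?thesis by (metis zero_setI)
qed

lemma zero_set_ge: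
  assumes "continuous_map X euclideanreal f"
  shows "zero_set X {x \<in> topspace X. f x \<ge> c}"
  using zero_set_le[of X "\<lambda>x. - f x" "- c"] assms by (simp add: continuous_map_minus)

lemma zero_set_Int:
  assumes "zero_set X A" "zero_set X B"
  shows "zero_set X (A \<inter> B)"
proof -
  obtain f g where f: "continuous_map X euclideanreal f" "A = {x \<in> topspace X. f x = 0}"
    and g: "continuous_map X euclideanreal g" "B = {x \<in> topspace X. g x = 0}"
    using assms by (auto simp: zero_set_def)
  have "continuous_map X euclideanreal (\<lambda>x. \<bar>f x\<bar> + \<bar>g x\<bar>)"
    using f g by (intro continuous_intros) auto
  moreover have "A \<inter> B = {x \<in> topspace X. \<bar>f x\<bar> + \<bar>g x\<bar> = 0}"
    using f g by auto
  ultimately show ?thesis by (metis zero_setI)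
qed

lemma closedin_zero_set:
  assumes "zero_set X Z"
  shows "closedin X Z"
proof -
  obtain f where f: "continuous_map X euclideanreal f" "Z = {x \<in> topspace X. f x = 0}"
    using assms by (auto simp: zero_set_def)
  then show ?thesis
    using closedin_continuous_map_preimage[OF f(1), of "{0}"] by simp
qed

text \<open>
  If \<open>Z\<^sub>n\<close> is the zero-set of \<open>g\<^sub>n\<close>, then \<open>h = \<Sum>n. min 1 \<bar>g\<^sub>n\<bar> / 2^(n+1)\<close> is continuous by
  uniform convergence, has no zeros because the \<open>Z\<^sub>n\<close> have no common point, and is at most
  \<open>1 / 2^n\<close> on \<open>Z\<^sub>n\<close> because the first terms of the series vanish there. So \<open>1 / h\<close> is as required.
\<close>

lemma decseq_zero_sets_imp_unbounded_function:
  assumes Z: "\<And>n. zero_set X (Z n)" and dec: "decseq Z" and empty: "(\<Inter>n. Z n) = {}"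
  obtains f where "continuous_map X euclideanreal f" "\<And>n x. x \<in> Z n \<Longrightarrow> f x \<ge> real n"
proof -
  obtain g where g: "\<And>n. continuous_map X euclideanreal (g n)"
    and Zg: "\<And>n. Z n = {x \<in> topspace X. g n x = 0}"
    using Z unfolding zero_set_def by metis
  define t :: "nat \<Rightarrow> 'a \<Rightarrow> real" where "t n x = min 1 \<bar>g n x\<bar> * (1/2) ^ Suc n" for n x
  define h where "h x = (\<Sum>n. t n x)" for x
  have t0: "t n x \<ge> 0" for n x by (simp add: t_def)
  have tle: "t n x \<le> (1/2) ^ Suc n" for n x
    by (simp add: t_def)
  have geo: "(\<lambda>n. (1/2) ^ Suc n :: real) sums 1"
    by (rule power_half_series)
  have sm: "summable (\<lambda>n. t n x)" for x
    by (rule summable_comparison_test'[OF sums_summable[OF geo]])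
       (use t0 tle in auto)
  have conth: "continuous_map X euclideanreal h"
  proof -
    have lim: "uniform_limit UNIV (\<lambda>n x. \<Sum>i<n. t i x) h sequentially"
      unfolding h_def
      by (rule Weierstrass_m_test[OF _ sums_summable[OF geo]]) (use t0 tle in auto)
    have "continuous_map X (Met_TC.mtopology :: real topology) h"
    proof (rule Met_TC.continuous_map_uniform_limit)
      have "continuous_map X euclideanreal (t n)" for n
        unfolding t_def using g by (intro continuous_intros) auto
      then show "\<forall>\<^sub>F n in sequentially.
          continuous_map X (Met_TC.mtopology :: real topology) (\<lambda>x. \<Sum>i<n. t i x)"
        by (intro always_eventually allI) (auto intro!: continuous_map_sum)
      show "\<forall>\<^sub>F n in sequentially.
          \<forall>x\<in>topspace X. h x \<in> UNIV \<and> dist (\<Sum>i<n. t i x) (h x) < e" if "e > 0" for e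
        using uniform_limitD[OF lim that] by (rule eventually_mono) auto
    qed simp
    then show ?thesis by simp
  qed
  have hpos: "h x > 0" if x: "x \<in> topspace X" for x
  proof -
    obtain n where "g n x \<noteq> 0" using empty x Zg by blast
    then have "t n x > 0" by (simp add: t_def)
    then show ?thesis unfolding h_def using suminf_pos_iff[OF sm] t0 by blast
  qed
  have hle: "h x \<le> (1/2) ^ n" if x: "x \<in> Z n" for n x
  proof -
    have "t k x = 0" if "k < n" for k
      using decseqD[OF dec, of k n] x that Zg[of k] by (auto simp: t_def)
    then have "h x = (\<Sum>k. t (k + n) x)"
      unfolding h_def using suminf_split_initial_segment[OF sm, of x n] by simp
    also have "\<dots> \<le> (\<Sum>k. (1/2) ^ n * (1/2) ^ Suc k)"
    proof (rule suminf_le)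
      show "t (k + n) x \<le> (1/2) ^ n * (1/2) ^ Suc k" for k
        using tle[of "k + n" x] by (simp add: power_add mult_ac)
      show "summable (\<lambda>k. t (k + n) x)" using sm by (subst summable_iff_shift)
      show "summable (\<lambda>k. (1/2) ^ n * (1/2) ^ Suc k :: real)"
        by (rule summable_mult[OF sums_summable[OF geo]])
    qed
    also have "\<dots> = (1/2) ^ n"
      using sums_unique[OF sums_mult[OF geo, of "(1/2) ^ n"]] by simp
    finally show ?thesis .
  qed
  show ?thesis
  proof
    show "continuous_map X euclideanreal (\<lambda>x. inverse (h x))"
      using conth hpos by (intro continuous_map_real_inverse) force+
    fix n x assume x: "x \<in> Z n"
    then have "h x > 0" using hpos Zg by blast
    then have "inverse ((1/2) ^ n) \<le> inverse (h x)"
      using hle[OF x] by (rule le_imp_inverse_le[rotated])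
    moreover have "real n \<le> inverse ((1/2) ^ n)"
      using of_nat_less_two_power[of n, where 'a = real] by (simp add: power_one_over)
    ultimately show "real n \<le> inverse (h x)" by (rule order_trans[rotated])
  qed
qed

section \<open>Ultrafilters of zero-sets\<close>

lemma z_filter_imp_z_ultrafilter:
  assumes "z_filter X \<F>"
  obtains \<G> where "z_ultrafilter X \<G>" "\<F> \<subseteq> \<G>"
proof -
  define \<A> where "\<A> = {\<G>. z_filter X \<G> \<and> \<F> \<subseteq> \<G>}"
  have "\<exists>M\<in>\<A>. \<forall>\<G>\<in>\<A>. M \<subseteq> \<G> \<longrightarrow> \<G> = M"
  proof (rule subset_Zorn_nonempty)
    show "\<A> \<noteq> {}" using assms by (auto simp: \<A>_def)
    fix \<C> assume ne: "\<C> \<noteq> {}" and ch: "subset.chain \<A> \<C>"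
    have filt: "z_filter X \<G>" "\<F> \<subseteq> \<G>" if "\<G> \<in> \<C>" for \<G>
      using ch that by (auto simp: subset.chain_def \<A>_def)
    have "A \<inter> B \<in> \<Union>\<C>" if AB: "A \<in> \<Union>\<C>" "B \<in> \<Union>\<C>" for A B
    proof -
      obtain \<G> \<H> where *: "\<G> \<in> \<C>" "\<H> \<in> \<C>" "A \<in> \<G>" "B \<in> \<H>" using AB by blast
      then have "\<G> \<subseteq> \<H> \<or> \<H> \<subseteq> \<G>"
        using ch by (auto simp: subset_chain_def)
      then obtain \<K> where "\<K> \<in> \<C>" "A \<in> \<K>" "B \<in> \<K>" using * by blast
      then show ?thesis using filt(1)[of \<K>] unfolding z_filter_def by blast
    qed
    moreover have "\<Union>\<C> \<subseteq> Collect (zero_set X)" "{} \<notin> \<Union>\<C>"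
      using filt(1) unfolding z_filter_def by blast+
    moreover have "\<Union>\<C> \<noteq> {}"
      using ne filt(1) unfolding z_filter_def by blast
    moreover have "B \<in> \<Union>\<C>" if "A \<in> \<Union>\<C>" "zero_set X B" "A \<subseteq> B" for A B
      using that filt(1) unfolding z_filter_def by blast
    ultimately have "z_filter X (\<Union>\<C>)" unfolding z_filter_def by blast
    then show "\<Union>\<C> \<in> \<A>" using ne filt(2) by (auto simp: \<A>_def)
  qed
  then obtain M where M: "M \<in> \<A>" "\<And>\<G>. \<G> \<in> \<A> \<Longrightarrow> M \<subseteq> \<G> \<Longrightarrow> \<G> = M" by blast
  then have "z_ultrafilter X M" by (auto simp: z_ultrafilter_def \<A>_def)
  with M show ?thesis using that by (auto simp: \<A>_def)
qed

text \<open>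
  The sets of a filter base on \<open>X\<close> need not be zero-sets. This is what allows the use below of the
  traces on \<open>X\<close> of the neighbourhoods of a point of \<open>\<beta>(X)\<close>, and of the sets
  \<open>{x \<in> C. \<bar>f x\<bar> \<ge> n}\<close> for an arbitrary closed set \<open>C\<close>.
\<close>

lemma filter_base_imp_z_ultrafilter:
  assumes ne: "\<C> \<noteq> {}" and sub: "\<And>C. C \<in> \<C> \<Longrightarrow> C \<subseteq> topspace X \<and> C \<noteq> {}"
    and dir: "\<And>C D. C \<in> \<C> \<Longrightarrow> D \<in> \<C> \<Longrightarrow> \<exists>E\<in>\<C>. E \<subseteq> C \<inter> D"
  obtains \<F> where "z_ultrafilter X \<F>" "\<And>C Z. C \<in> \<C> \<Longrightarrow> zero_set X Z \<Longrightarrow> C \<subseteq> Z \<Longrightarrow> Z \<in> \<F>"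
proof -
  define \<G> where "\<G> = {Z. zero_set X Z \<and> (\<exists>C\<in>\<C>. C \<subseteq> Z)}"
  have "A \<inter> B \<in> \<G>" if AB: "A \<in> \<G>" "B \<in> \<G>" for A B
  proof -
    obtain C D where "C \<in> \<C>" "D \<in> \<C>" "C \<subseteq> A" "D \<subseteq> B" using AB by (auto simp: \<G>_def)
    then obtain E where "E \<in> \<C>" "E \<subseteq> A \<inter> B" using dir by (meson Int_mono subset_trans)
    then show ?thesis using AB by (auto simp: \<G>_def zero_set_Int)
  qed
  moreover have "topspace X \<in> \<G>" using ne sub by (auto simp: \<G>_def zero_set_topspace)
  moreover have "{} \<notin> \<G>" using sub by (auto simp: \<G>_def)
  moreover have "B \<in> \<G>" if "A \<in> \<G>" "zero_set X B" "A \<subseteq> B" for A B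
    using that unfolding \<G>_def by blast
  moreover have "\<G> \<subseteq> Collect (zero_set X)" by (auto simp: \<G>_def)
  ultimately have "z_filter X \<G>" unfolding z_filter_def by blast
  then obtain \<F> where "z_ultrafilter X \<F>" "\<G> \<subseteq> \<F>" by (rule z_filter_imp_z_ultrafilter)
  then show ?thesis using that unfolding \<G>_def by blast
qed

lemma z_ultrafilter_Int_nonempty:
  "z_ultrafilter X \<F> \<Longrightarrow> A \<in> \<F> \<Longrightarrow> B \<in> \<F> \<Longrightarrow> A \<inter> B \<noteq> {}"
  unfolding z_ultrafilter_def z_filter_def by metis

lemma z_ultrafilter_Inter_mem:
  assumes \<F>: "z_ultrafilter X \<F>" and "finite \<A>" "\<A> \<subseteq> \<F>" "\<A> \<noteq> {}"
  shows "\<Inter>\<A> \<in> \<F>"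
  using assms(2,4,3)
proof (induction \<A> rule: finite_ne_induct)
  case (insert A \<A>)
  then show ?case using \<F> by (simp add: z_ultrafilter_def z_filter_def)
qed simp

text \<open>
  A zero-set that meets every member of a \<open>z\<close>-filter generates a larger \<open>z\<close>-filter together
  with it, so by maximality it is already a member.
\<close>

lemma z_ultrafilter_memI:
  assumes \<F>: "z_ultrafilter X \<F>" and Z: "zero_set X Z" and meets: "\<And>A. A \<in> \<F> \<Longrightarrow> A \<inter> Z \<noteq> {}"
  shows "Z \<in> \<F>"
proof -
  have filt: "z_filter X \<F>" using \<F> by (simp add: z_ultrafilter_def)
  define \<C> where "\<C> = (\<lambda>A. A \<inter> Z) ` \<F>"
  have dir: "\<exists>E\<in>\<C>. E \<subseteq> C \<inter> D" if CD: "C \<in> \<C>" "D \<in> \<C>" for C D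
  proof -
    obtain A B where "A \<in> \<F>" "B \<in> \<F>" "C = A \<inter> Z" "D = B \<inter> Z" using CD by (auto simp: \<C>_def)
    moreover from this have "A \<inter> B \<in> \<F>" using filt by (auto simp: z_filter_def)
    ultimately show ?thesis by (intro bexI[of _ "A \<inter> B \<inter> Z"]) (auto simp: \<C>_def)
  qed
  obtain \<G> where \<G>: "z_ultrafilter X \<G>"
    "\<And>C Z. C \<in> \<C> \<Longrightarrow> zero_set X Z \<Longrightarrow> C \<subseteq> Z \<Longrightarrow> Z \<in> \<G>"
  proof (rule filter_base_imp_z_ultrafilter[of \<C> X])
    show "\<C> \<noteq> {}" using filt by (auto simp: \<C>_def z_filter_def)
    show "C \<subseteq> topspace X \<and> C \<noteq> {}" if "C \<in> \<C>" for C
      using that meets zero_set_subset[OF Z] by (auto simp: \<C>_def)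
  qed (use dir in auto)
  have sub: "A \<in> \<G>" if "A \<in> \<F>" for A
    using \<G>(2)[of "A \<inter> Z" A] that filt by (auto simp: \<C>_def z_filter_def)
  have "Z \<in> \<G>"
    using filt \<G>(2)[OF _ Z] by (auto simp: \<C>_def z_filter_def)
  moreover have "\<G> = \<F>"
    using \<F> \<G>(1) sub unfolding z_ultrafilter_def by blast
  ultimately show ?thesis by simp
qed

section \<open>Extensions to the Stone-Cech compactification\<close>

lemma is_sc_ext_sc_ext:
  "continuous_map X euclideanreal f \<Longrightarrow> is_sc_ext X f (sc_ext X f)"
  unfolding sc_ext_def by (rule theI'[OF ex1_sc_ext])

lemma sc_ext_embed:
  "continuous_map X euclideanreal f \<Longrightarrow> x \<in> topspace X \<Longrightarrow> sc_ext X f (sc_embed X x) = Some (f x)"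
  using is_sc_ext_sc_ext by (auto simp: is_sc_ext_def)

lemma continuous_map_sc_ext:
  "continuous_map X euclideanreal f \<Longrightarrow>
   continuous_map (stone_cech X) (Alexandroff_compactification euclideanreal) (sc_ext X f)"
  using is_sc_ext_sc_ext by (auto simp: is_sc_ext_def)

lemma sc_embed_in_stone_cech: "x \<in> topspace X \<Longrightarrow> sc_embed X x \<in> topspace (stone_cech X)"
  unfolding topspace_stone_cech
  by (rule subsetD[OF closure_of_subset[OF sc_embed_in_cube] imageI])

lemma sc_embed_dense:
  assumes "openin (stone_cech X) U" "p \<in> U"
  obtains x where "x \<in> topspace X" "sc_embed X x \<in> U"
proof -
  obtain V where V: "openin (unit_cube X) V"
    "U = V \<inter> (unit_cube X closure_of (sc_embed X ` topspace X))"
    using assms(1) by (auto simp: stone_cech_def openin_subtopology)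
  then obtain x where x: "x \<in> topspace X" "sc_embed X x \<in> V"
    using assms(2) by (auto simp: in_closure_of)
  then have "sc_embed X x \<in> U"
    using V sc_embed_in_stone_cech[OF x(1)] by (simp add: topspace_stone_cech)
  with x that show ?thesis by blast
qed

lemma sc_ext_infinite_nbhd:
  assumes f: "continuous_map X euclideanreal f" and p: "p \<in> topspace (stone_cech X)"
    and inf: "sc_ext X f p = None"
  obtains U where "openin (stone_cech X) U" "p \<in> U"
    "\<And>x. x \<in> topspace X \<Longrightarrow> sc_embed X x \<in> U \<Longrightarrow> \<bar>f x\<bar> > c"
proof
  let ?V = "insert None (Some ` (topspace euclideanreal - {-c..c}))"
  let ?U = "{q \<in> topspace (stone_cech X). sc_ext X f q \<in> ?V}"
  have "openin (Alexandroff_compactification euclideanreal) ?V"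
    unfolding openin_Alexandroff_compactification
    by (intro disjI2 exI[of _ "{-c..c}"]) auto
  then show "openin (stone_cech X) ?U"
    by (rule openin_continuous_map_preimage[OF continuous_map_sc_ext[OF f]])
  show "p \<in> ?U" using p inf by simp
  show "\<bar>f x\<bar> > c" if "x \<in> topspace X" "sc_embed X x \<in> ?U" for x
    using that sc_ext_embed[OF f that(1)] by auto
qed

lemma sc_ext_finite_nbhd:
  assumes f: "continuous_map X euclideanreal f" and p: "p \<in> topspace (stone_cech X)"
    and fin: "sc_ext X f p \<noteq> None"
  obtains U c where "openin (stone_cech X) U" "p \<in> U"
    "\<And>x. x \<in> topspace X \<Longrightarrow> sc_embed X x \<in> U \<Longrightarrow> f x \<le> c"
proof -
  obtain r where r: "sc_ext X f p = Some r" using fin by blast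
  let ?U = "{q \<in> topspace (stone_cech X). sc_ext X f q \<in> Some ` {..< r + 1}}"
  show ?thesis
  proof
    have "openin (Alexandroff_compactification euclideanreal) (Some ` {..< r + 1})"
      unfolding openin_Alexandroff_compactification
      by (intro disjI1 exI[of _ "{..< r + 1}"]) auto
    then show "openin (stone_cech X) ?U"
      by (rule openin_continuous_map_preimage[OF continuous_map_sc_ext[OF f]])
    show "p \<in> ?U" using p r by simp
    show "f x \<le> r + 1" if "x \<in> topspace X" "sc_embed X x \<in> ?U" for x
      using that sc_ext_embed[OF f that(1)] by auto
  qed
qed

text \<open>The extension of \<open>f\<close> has the finite value \<open>f x\<close> at a point \<open>x\<close> of \<open>X\<close>.\<close>

lemma realcompact_universe_iff_upsilon_subset:
  "realcompact_universe X \<B> \<longleftrightarrow> upsilon X \<B> \<subseteq> sc_embed X ` topspace X"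
proof -
  have "sc_embed X ` topspace X \<subseteq> upsilon X \<B>"
    by (auto simp: upsilon_def bdd_cont_def sc_embed_in_stone_cech sc_ext_embed)
  then show ?thesis by (auto simp: realcompact_universe_def)
qed

text \<open>
  The closures in \<open>\<beta>(X)\<close> of the members of a \<open>z\<close>-ultrafilter have the finite intersection
  property, so by compactness they share a point.
\<close>

lemma z_ultrafilter_cluster_point:
  assumes \<F>: "z_ultrafilter X \<F>"
  obtains p where "p \<in> topspace (stone_cech X)"
    "\<And>A U. A \<in> \<F> \<Longrightarrow> openin (stone_cech X) U \<Longrightarrow> p \<in> U \<Longrightarrow> \<exists>x\<in>A. sc_embed X x \<in> U"
proof -
  have filt: "z_filter X \<F>" using \<F> by (simp add: z_ultrafilter_def)
  define cl where "cl A = stone_cech X closure_of (sc_embed X ` A)" for A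
  have embcl: "sc_embed X x \<in> cl A" if "x \<in> A" "A \<in> \<F>" for x A
  proof -
    have "A \<subseteq> topspace X" using that filt by (auto simp: z_filter_def dest: zero_set_subset)
    then have "sc_embed X ` A \<subseteq> topspace (stone_cech X)"
      by (auto intro: sc_embed_in_stone_cech)
    then show ?thesis
      unfolding cl_def by (rule subsetD[OF closure_of_subset imageI[OF that(1)]])
  qed
  have "\<Inter>(cl ` \<F>) \<noteq> {}"
  proof (rule compact_space_fip[THEN iffD1, rule_format, OF compact_Hausdorff_stone_cech(1)], safe)
    show "closedin (stone_cech X) (cl A)" for A by (simp add: cl_def)
    fix \<D> assume fin: "finite \<D>" and sub: "\<D> \<subseteq> cl ` \<F>" and empty: "\<Inter>\<D> = {}"
    then obtain \<A> where \<A>: "finite \<A>" "\<A> \<subseteq> \<F>" "\<D> = cl ` \<A>" by (meson finite_subset_image)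
    have "\<A> \<noteq> {}" using empty \<A>(3) by auto
    then have "\<Inter>\<A> \<in> \<F>" by (rule z_ultrafilter_Inter_mem[OF \<F> \<A>(1,2)])
    then have "\<Inter>\<A> \<noteq> {}" using filt by (auto simp: z_filter_def)
    then obtain x where "\<And>A. A \<in> \<A> \<Longrightarrow> x \<in> A" by blast
    then have "sc_embed X x \<in> \<Inter>\<D>" using \<A> embcl by blast
    then show False using empty by simp
  qed
  then obtain p where p: "\<And>A. A \<in> \<F> \<Longrightarrow> p \<in> cl A" by blast
  show ?thesis
  proof
    obtain A where "A \<in> \<F>" using filt by (auto simp: z_filter_def)
    then show "p \<in> topspace (stone_cech X)" using p[of A] by (simp add: cl_def in_closure_of)
    show "\<exists>x\<in>A. sc_embed X x \<in> U" if "A \<in> \<F>" "openin (stone_cech X) U" "p \<in> U" for A U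
      using p[OF that(1)] that by (auto simp: cl_def in_closure_of)
  qed
qed

text \<open>
  Some coordinate \<open>h\<close> of the cube separates \<open>p\<close> from the image of \<open>x\<close>, so the points
  of \<open>X\<close> at which \<open>h\<close> is close to the \<open>h\<close>-coordinate of \<open>p\<close> form a zero-set that avoids \<open>x\<close>.
\<close>

lemma remainder_zero_set_nbhd_avoiding:
  assumes p: "p \<in> topspace (stone_cech X)" "p \<notin> sc_embed X ` topspace X" and x: "x \<in> topspace X"
  obtains U Z where "openin (stone_cech X) U" "p \<in> U" "zero_set X Z" "x \<notin> Z"
    "\<And>y. y \<in> topspace X \<Longrightarrow> sc_embed X y \<in> U \<Longrightarrow> y \<in> Z"
proof -
  have pc: "p \<in> topspace (unit_cube X)"
    using p(1) by (auto simp: stone_cech_def)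
  have "p \<noteq> sc_embed X x" using p x by blast
  moreover have "p \<in> extensional (unit_maps X)"
    using pc by (auto simp: unit_cube_def PiE_iff)
  ultimately obtain h where h: "h \<in> unit_maps X" "p h \<noteq> h x"
    unfolding sc_embed_def by (metis (no_types, lifting) extensionalityI restrict_apply' restrict_extensional)
  have ch: "continuous_map X euclideanreal h"
    using h(1) by (auto simp: unit_maps_def continuous_map_in_subtopology)
  define d where "d = \<bar>h x - p h\<bar> / 2"
  have d: "d > 0" using h(2) by (simp add: d_def)
  define Z where "Z = {y \<in> topspace X. \<bar>h y - p h\<bar> \<le> d}"
  have "continuous_map (unit_cube X) (top_of_set {0..1}) (\<lambda>q. q h)"
    unfolding unit_cube_def using h(1) by (rule continuous_map_product_projection)
  then have "continuous_map (stone_cech X) euclideanreal (\<lambda>q. q h)"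
    unfolding stone_cech_def
    by (intro continuous_map_from_subtopology) (simp add: continuous_map_in_subtopology)
  then have op: "openin (stone_cech X) {q \<in> topspace (stone_cech X). q h \<in> ball (p h) d}"
    by (rule openin_continuous_map_preimage) simp
  show ?thesis
  proof (rule that[OF op])
    show "p \<in> {q \<in> topspace (stone_cech X). q h \<in> ball (p h) d}" using p d by simp
    have "continuous_map X euclideanreal (\<lambda>y. \<bar>h y - p h\<bar>)"
      using ch by (intro continuous_intros) auto
    then show "zero_set X Z" unfolding Z_def by (rule zero_set_le)
    show "x \<notin> Z" using d by (simp add: Z_def d_def)
    show "y \<in> Z" if "y \<in> topspace X"
      "sc_embed X y \<in> {q \<in> topspace (stone_cech X). q h \<in> ball (p h) d}" for y
      using that h(1) by (auto simp: Z_def sc_embed_def dist_real_def)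
  qed
qed

text \<open>
  The traces on \<open>X\<close> of the neighbourhoods of \<open>p\<close> are non-empty by density, so they are a filter
  base. Any \<open>z\<close>-ultrafilter through it is free, as every point of \<open>X\<close> can be separated
  from \<open>p\<close> by a zero-set.
\<close>

lemma remainder_point_imp_free_z_ultrafilter:
  assumes p: "p \<in> topspace (stone_cech X)" "p \<notin> sc_embed X ` topspace X"
  obtains \<F> where "z_ultrafilter X \<F>" "\<not> fixed_family \<F>"
    "\<And>U Z. openin (stone_cech X) U \<Longrightarrow> p \<in> U \<Longrightarrow> zero_set X Z \<Longrightarrow>
       (\<And>x. x \<in> topspace X \<Longrightarrow> sc_embed X x \<in> U \<Longrightarrow> x \<in> Z) \<Longrightarrow> Z \<in> \<F>"
proof -
  define tr where "tr U = {x \<in> topspace X. sc_embed X x \<in> U}" for U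
  define \<C> where "\<C> = tr ` {U. openin (stone_cech X) U \<and> p \<in> U}"
  have dir: "\<exists>E\<in>\<C>. E \<subseteq> C \<inter> D" if CD: "C \<in> \<C>" "D \<in> \<C>" for C D
  proof -
    obtain U V where "openin (stone_cech X) U" "p \<in> U" "C = tr U"
      "openin (stone_cech X) V" "p \<in> V" "D = tr V" using CD by (auto simp: \<C>_def)
    then show ?thesis
      by (intro bexI[of _ "tr (U \<inter> V)"]) (auto simp: \<C>_def tr_def)
  qed
  obtain \<F> where \<F>: "z_ultrafilter X \<F>"
    "\<And>C Z. C \<in> \<C> \<Longrightarrow> zero_set X Z \<Longrightarrow> C \<subseteq> Z \<Longrightarrow> Z \<in> \<F>"
  proof (rule filter_base_imp_z_ultrafilter[of \<C> X])
    show "\<C> \<noteq> {}" using p(1) by (auto simp: \<C>_def)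
    show "C \<subseteq> topspace X \<and> C \<noteq> {}" if C: "C \<in> \<C>" for C
    proof -
      obtain U where U: "openin (stone_cech X) U" "p \<in> U" "C = tr U"
        using C by (auto simp: \<C>_def)
      then obtain x where "x \<in> topspace X" "sc_embed X x \<in> U" by (blast elim: sc_embed_dense)
      then show ?thesis using U(3) by (auto simp: tr_def)
    qed
  qed (use dir in auto)
  have mem: "Z \<in> \<F>" if "openin (stone_cech X) U" "p \<in> U" "zero_set X Z"
    "\<And>x. x \<in> topspace X \<Longrightarrow> sc_embed X x \<in> U \<Longrightarrow> x \<in> Z" for U Z
    by (rule \<F>(2)[of "tr U"]) (use that in \<open>auto simp: \<C>_def tr_def\<close>)
  have "\<not> fixed_family \<F>"
  proof
    assume "fixed_family \<F>"
    then obtain x where x: "\<And>A. A \<in> \<F> \<Longrightarrow> x \<in> A" by (auto simp: fixed_family_def)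
    have "topspace X \<in> \<F>"
      using mem[OF openin_topspace p(1) zero_set_topspace] by blast
    then obtain U Z where "openin (stone_cech X) U" "p \<in> U" "zero_set X Z" "x \<notin> Z"
      "\<And>y. y \<in> topspace X \<Longrightarrow> sc_embed X y \<in> U \<Longrightarrow> y \<in> Z"
      using remainder_zero_set_nbhd_avoiding[OF p x] by blast
    then show False using mem x by blast
  qed
  with \<F>(1) mem that show ?thesis by blast
qed

section \<open>Realcompactness and unbounded sequences\<close>

definition contains_unbounded_seq :: "'a topology \<Rightarrow> 'a set set \<Rightarrow> 'a set set \<Rightarrow> bool" where
  "contains_unbounded_seq X \<B> \<F> \<longleftrightarrow>
     (\<exists>Z :: nat \<Rightarrow> 'a set. (\<forall>n. zero_set X (Z n)) \<and> decseq Z \<and>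
        unbounded_seq X \<B> Z \<and> (\<forall>n. Z n \<in> \<F>))"

text \<open>
  A bound for the continuous function \<open>\<bar>f\<bar>\<close> on \<open>B\<close> remains one on the closure of \<open>B\<close>, so
  the closure misses \<open>{x. \<bar>f x\<bar> \<ge> n}\<close> as soon as \<open>n\<close> exceeds the bound.
\<close>

lemma unbounded_seq_level_sets:
  assumes "f \<in> bdd_cont X \<B>" and sub: "\<And>B. B \<in> \<B> \<Longrightarrow> B \<subseteq> topspace X"
  shows "unbounded_seq X \<B> (\<lambda>n. {x \<in> topspace X. \<bar>f x\<bar> \<ge> real n})"
  unfolding unbounded_seq_def
proof
  fix B assume B: "B \<in> \<B>"
  have f: "continuous_map X euclideanreal f" using assms by (simp add: bdd_cont_def)
  have "bounded (f ` B)" using assms(1) B by (simp add: bdd_cont_def)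
  then obtain b where b: "\<And>x. x \<in> B \<Longrightarrow> \<bar>f x\<bar> \<le> b" by (auto simp: bounded_iff)
  have cl: "closedin X {x \<in> topspace X. \<bar>f x\<bar> \<le> b}"
    by (rule closedin_zero_set[OF zero_set_le]) (use f in \<open>intro continuous_intros\<close>)
  have "X closure_of B \<subseteq> {x \<in> topspace X. \<bar>f x\<bar> \<le> b}"
    by (rule closure_of_minimal[OF _ cl]) (use sub[OF B] b in auto)
  moreover obtain n :: nat where "real n > b" using reals_Archimedean2 by blast
  ultimately show "\<exists>n. (X closure_of B) \<inter> {x \<in> topspace X. \<bar>f x\<bar> \<ge> real n} = {}"
    by (intro exI[of _ n]) force
qed

text \<open>
  A cluster point \<open>p\<close> of \<open>\<F>\<close> in \<open>\<beta>(X)\<close> lies outside \<open>X\<close>, since \<open>\<F>\<close> is free and consists of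
  closed sets. Realcompactness then supplies \<open>f \<in> C\<^sub>\<B>(X)\<close> with \<open>f\<^sup>\<beta>(p) = \<infinity>\<close>. Near \<open>p\<close>
  the values of \<open>\<bar>f\<bar>\<close> exceed any given \<open>n\<close>, so every member of \<open>\<F>\<close> meets
  \<open>{x. \<bar>f x\<bar> \<ge> n}\<close>, and by maximality this set belongs to \<open>\<F>\<close>.
\<close>

lemma realcompact_imp_unbounded_free:
  assumes rc: "realcompact_universe X \<B>" and born: "bornological_universe X \<B>"
    and cr: "completely_regular_space X" and T2: "Hausdorff_space X"
    and \<F>: "z_ultrafilter X \<F>" and free: "\<not> fixed_family \<F>"
  shows "contains_unbounded_seq X \<B> \<F>"
proof -
  have filt: "z_filter X \<F>" using \<F> by (simp add: z_ultrafilter_def)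
  obtain p where p: "p \<in> topspace (stone_cech X)"
    and cluster: "\<And>A U. A \<in> \<F> \<Longrightarrow> openin (stone_cech X) U \<Longrightarrow> p \<in> U \<Longrightarrow> \<exists>x\<in>A. sc_embed X x \<in> U"
    using z_ultrafilter_cluster_point[OF \<F>] by blast
  have "p \<notin> sc_embed X ` topspace X"
  proof
    assume "p \<in> sc_embed X ` topspace X"
    then obtain x where x: "x \<in> topspace X" "p = sc_embed X x" by blast
    have "x \<in> A" if A: "A \<in> \<F>" for A
    proof (rule ccontr)
      assume "x \<notin> A"
      have clA: "closedin X A" using A filt by (auto simp: z_filter_def closedin_zero_set)
      \<comment> \<open>As \<open>X\<close> is embedded, the complement of \<open>A\<close> is the trace of an open set of \<open>\<beta>(X)\<close>.\<close>
      obtain U where U: "openin (stone_cech X) U"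
        "sc_embed X ` (topspace X - A) = U \<inter> sc_embed X ` topspace X"
      proof -
        have "open_map X (subtopology (stone_cech X) (sc_embed X ` topspace X)) (sc_embed X)"
          using embedding_sc_embed[OF cr T2]
          by (simp add: embedding_map_def homeomorphic_imp_open_map)
        then have "openin (subtopology (stone_cech X) (sc_embed X ` topspace X))
            (sc_embed X ` (topspace X - A))"
          using clA by (simp add: open_map_def closedin_def)
        with that show ?thesis by (auto simp: openin_subtopology)
      qed
      have "p \<in> U" using x \<open>x \<notin> A\<close> U(2) by blast
      then obtain y where y: "y \<in> A" "sc_embed X y \<in> U" using cluster[OF A U(1)] by blast
      have yX: "y \<in> topspace X" using y clA closedin_subset by blast
      then have "sc_embed X y \<in> sc_embed X ` (topspace X - A)" using U(2) y by blast
      moreover have "inj_on (sc_embed X) (topspace X)"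
        using embedding_sc_embed[OF cr T2]
        by (auto simp: embedding_map_def homeomorphic_eq_everything_map)
      ultimately show False using y yX by (auto dest: inj_onD)
    qed
    then show False using free by (auto simp: fixed_family_def)
  qed
  then have "p \<notin> upsilon X \<B>" using rc by (simp add: realcompact_universe_def)
  then obtain f where fB: "f \<in> bdd_cont X \<B>" and inf: "sc_ext X f p = None"
    using p by (auto simp: upsilon_def)
  have f: "continuous_map X euclideanreal f" using fB by (simp add: bdd_cont_def)
  define Z where "Z n = {x \<in> topspace X. \<bar>f x\<bar> \<ge> real n}" for n
  have Z: "zero_set X (Z n)" for n
    unfolding Z_def by (rule zero_set_ge) (use f in \<open>intro continuous_intros\<close>)
  have "decseq Z" by (force simp: decseq_def Z_def)
  moreover have "unbounded_seq X \<B> Z"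
    unfolding Z_def
    by (rule unbounded_seq_level_sets[OF fB])
       (use born in \<open>auto simp: bornological_universe_def bornology_on_def\<close>)
  moreover have "Z n \<in> \<F>" for n
  proof (rule z_ultrafilter_memI[OF \<F> Z])
    fix A assume A: "A \<in> \<F>"
    obtain U where U: "openin (stone_cech X) U" "p \<in> U"
      "\<And>x. x \<in> topspace X \<Longrightarrow> sc_embed X x \<in> U \<Longrightarrow> \<bar>f x\<bar> > real n"
      using sc_ext_infinite_nbhd[OF f p inf] by blast
    then obtain x where x: "x \<in> A" "sc_embed X x \<in> U" using cluster[OF A] by blast
    moreover have "x \<in> topspace X"
      using x A filt by (auto simp: z_filter_def dest: zero_set_subset)
    ultimately show "A \<inter> Z n \<noteq> {}" using U(3)[of x] by (force simp: Z_def)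
  qed
  ultimately show ?thesis
    using Z unfolding contains_unbounded_seq_def by (intro exI[of _ Z] conjI allI)
qed

text \<open>
  Otherwise the sets \<open>cl B \<inter> {x. \<bar>f x\<bar> \<ge> n}\<close> form a filter base. A \<open>z\<close>-ultrafilter through
  it is free because no point satisfies \<open>\<bar>f x\<bar> \<ge> n\<close> for all \<open>n\<close>, so it contains some zero-set
  disjoint from \<open>cl B\<close>. Urysohn's lemma encloses \<open>cl B\<close> in a zero-set disjoint from that one,
  and it belongs to the \<open>z\<close>-ultrafilter too, which is absurd.
\<close>

lemma continuous_imp_bounded_on_bornology:
  assumes free_unbdd: "\<And>\<F>. z_ultrafilter X \<F> \<Longrightarrow> \<not> fixed_family \<F> \<Longrightarrow> contains_unbounded_seq X \<B> \<F>"
    and norm: "normal_space X" and f: "continuous_map X euclideanreal f"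
    and B: "B \<in> \<B>" "B \<subseteq> topspace X"
  shows "bounded (f ` B)"
proof (rule ccontr)
  assume unbdd: "\<not> bounded (f ` B)"
  define K where "K = X closure_of B"
  have KX: "K \<subseteq> topspace X" and BK: "B \<subseteq> K"
    unfolding K_def by (rule closure_of_subset_topspace, rule closure_of_subset[OF B(2)])
  define L where "L n = {x \<in> topspace X. \<bar>f x\<bar> \<ge> real n}" for n
  have L: "zero_set X (L n)" for n
    unfolding L_def by (rule zero_set_ge) (use f in \<open>intro continuous_intros\<close>)
  have Ldec: "K \<inter> L (max m n) \<subseteq> (K \<inter> L m) \<inter> (K \<inter> L n)" for m n
    by (auto simp: L_def)
  have ne: "K \<inter> L n \<noteq> {}" for n
  proof -
    have "\<exists>x\<in>B. \<not> \<bar>f x\<bar> \<le> real n"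
      using unbdd unfolding bounded_iff by (metis imageE real_norm_def)
    then obtain x where "x \<in> B" "\<bar>f x\<bar> \<ge> real n" by (meson linear)
    then have "x \<in> K \<inter> L n" using BK B(2) by (auto simp: L_def)
    then show ?thesis by blast
  qed
  obtain \<F> where \<F>: "z_ultrafilter X \<F>"
    and mem: "\<And>C Z. C \<in> range (\<lambda>n. K \<inter> L n) \<Longrightarrow> zero_set X Z \<Longrightarrow> C \<subseteq> Z \<Longrightarrow> Z \<in> \<F>"
  proof (rule filter_base_imp_z_ultrafilter[of "range (\<lambda>n. K \<inter> L n)" X])
    show "C \<subseteq> topspace X \<and> C \<noteq> {}" if "C \<in> range (\<lambda>n. K \<inter> L n)" for C
      using that KX ne by blast
    fix C D assume "C \<in> range (\<lambda>n. K \<inter> L n)" "D \<in> range (\<lambda>n. K \<inter> L n)"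
    then obtain m n where "C = K \<inter> L m" "D = K \<inter> L n" by blast
    then show "\<exists>E\<in>range (\<lambda>n. K \<inter> L n). E \<subseteq> C \<inter> D"
      using Ldec[of m n] by (intro bexI[OF _ rangeI[of _ "max m n"]]) simp
  qed auto
  have "\<not> fixed_family \<F>"
  proof
    assume "fixed_family \<F>"
    then obtain x where x: "\<And>A. A \<in> \<F> \<Longrightarrow> x \<in> A" by (auto simp: fixed_family_def)
    obtain n :: nat where "\<bar>f x\<bar> < real n" using reals_Archimedean2 by blast
    moreover have "x \<in> L n" by (rule x[OF mem[OF _ L]]) auto
    ultimately show False by (simp add: L_def)
  qed
  then obtain Z where Z: "\<And>n. zero_set X (Z n)" "unbounded_seq X \<B> Z" "\<And>n. Z n \<in> \<F>"
    using free_unbdd[OF \<F>] unfolding contains_unbounded_seq_def by blast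
  then obtain n where n: "K \<inter> Z n = {}" using B(1) by (auto simp: unbounded_seq_def K_def)
  obtain g where g: "continuous_map X euclideanreal g" "g ` K \<subseteq> {0}" "g ` Z n \<subseteq> {1}"
  proof (rule Urysohn_lemma_alt[OF norm])
    show "closedin X K" by (simp add: K_def)
    show "closedin X (Z n)" by (rule closedin_zero_set[OF Z(1)])
    show "disjnt K (Z n)" using n by (simp add: disjnt_def)
  qed
  define W where "W = {x \<in> topspace X. g x = 0}"
  have "W \<in> \<F>"
    by (rule mem[of "K \<inter> L 0"]) (use g KX in \<open>auto simp: W_def intro: zero_setI\<close>)
  then have "W \<inter> Z n \<noteq> {}" using z_ultrafilter_Int_nonempty[OF \<F>] Z(3) by blast
  then show False using g(3) by (auto simp: W_def)
qed

text \<open>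
  Let \<open>p\<close> be a point of \<open>\<upsilon>\<^sub>\<B>(X)\<close> outside \<open>X\<close>. A free \<open>z\<close>-ultrafilter converging to \<open>p\<close> contains
  an unbounded sequence \<open>(Z\<^sub>n)\<close>, hence some continuous \<open>f\<close> satisfies \<open>f \<ge> n\<close> on \<open>Z\<^sub>n\<close>. But all
  continuous functions belong to \<open>C\<^sub>\<B>(X)\<close> here, so \<open>f\<^sup>\<beta>(p)\<close> is finite and \<open>f\<close> is bounded above
  on a member of the \<open>z\<close>-ultrafilter, which has to miss \<open>Z\<^sub>n\<close> for large \<open>n\<close>.
\<close>

lemma unbounded_free_imp_realcompact:
  assumes free_unbdd: "\<And>\<F>. z_ultrafilter X \<F> \<Longrightarrow> \<not> fixed_family \<F> \<Longrightarrow> contains_unbounded_seq X \<B> \<F>"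
    and born: "bornological_universe X \<B>" and norm: "normal_space X"
  shows "realcompact_universe X \<B>"
  unfolding realcompact_universe_iff_upsilon_subset
proof
  fix p assume up: "p \<in> upsilon X \<B>"
  then have p: "p \<in> topspace (stone_cech X)" by (simp add: upsilon_def)
  have sub: "B \<subseteq> topspace X" if "B \<in> \<B>" for B
    using that born by (auto simp: bornological_universe_def bornology_on_def)
  have sing: "{x} \<in> \<B>" if "x \<in> topspace X" for x
    using that born by (auto simp: bornological_universe_def bornology_on_def)
  show "p \<in> sc_embed X ` topspace X"
  proof (rule ccontr)
    assume "p \<notin> sc_embed X ` topspace X"
    then obtain \<F> where \<F>: "z_ultrafilter X \<F>" "\<not> fixed_family \<F>"
      and conv: "\<And>U Z. openin (stone_cech X) U \<Longrightarrow> p \<in> U \<Longrightarrow> zero_set X Z \<Longrightarrow>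
       (\<And>x. x \<in> topspace X \<Longrightarrow> sc_embed X x \<in> U \<Longrightarrow> x \<in> Z) \<Longrightarrow> Z \<in> \<F>"
      using remainder_point_imp_free_z_ultrafilter[OF p] by blast
    obtain Z where Z: "\<And>n. zero_set X (Z n)" "decseq Z" "unbounded_seq X \<B> Z" "\<And>n. Z n \<in> \<F>"
      using free_unbdd[OF \<F>] unfolding contains_unbounded_seq_def by blast
    \<comment> \<open>Singletons belong to the bornology, so no point lies in every term of the sequence.\<close>
    have "(\<Inter>n. Z n) = {}"
    proof (rule ccontr)
      assume "(\<Inter>n. Z n) \<noteq> {}"
      then obtain x where x: "\<And>n. x \<in> Z n" by blast
      then have xX: "x \<in> topspace X" using zero_set_subset[OF Z(1)] by blast
      then have "x \<in> X closure_of {x}" by (simp add: in_closure_of)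
      then show False using Z(3) sing[OF xX] x unfolding unbounded_seq_def by blast
    qed
    then obtain f where f: "continuous_map X euclideanreal f" "\<And>n x. x \<in> Z n \<Longrightarrow> f x \<ge> real n"
      using decseq_zero_sets_imp_unbounded_function[of X Z] Z by blast
    have "f \<in> bdd_cont X \<B>"
      using continuous_imp_bounded_on_bornology[OF free_unbdd norm f(1)] f(1) sub
      by (simp add: bdd_cont_def)
    then have "sc_ext X f p \<noteq> None" using up by (simp add: upsilon_def)
    then obtain U c where U: "openin (stone_cech X) U" "p \<in> U"
      "\<And>x. x \<in> topspace X \<Longrightarrow> sc_embed X x \<in> U \<Longrightarrow> f x \<le> c"
      using sc_ext_finite_nbhd[OF f(1) p] by blast
    have "{x \<in> topspace X. f x \<le> c} \<in> \<F>"
      by (rule conv[OF U(1,2) zero_set_le[OF f(1)]]) (use U(3) in auto)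
    moreover obtain n :: nat where "real n > c" using reals_Archimedean2 by blast
    ultimately have "{x \<in> topspace X. f x \<le> c} \<inter> Z n \<noteq> {}"
      using z_ultrafilter_Int_nonempty[OF \<F>(1)] Z(4) by blast
    then show False using f(2)[of _ n] \<open>real n > c\<close> by force
  qed
qed

theorem proposition21:
  fixes X :: "'a topology" and \<B> :: "'a set set"
  assumes "bornological_universe X \<B>"
    and "normal_space X"
    and "Hausdorff_space X"
  shows "realcompact_universe X \<B> \<longleftrightarrow>
    (\<forall>\<F>. z_ultrafilter X \<F> \<longrightarrow>
        \<not> (\<exists>Z :: nat \<Rightarrow> 'a set. (\<forall>n. zero_set X (Z n)) \<and> decseq Z \<and>
               unbounded_seq X \<B> Z \<and> (\<forall>n. Z n \<in> \<F>)) \<longrightarrow>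
        fixed_family \<F>)"
proof -
  have "completely_regular_space X"
    using assms by (simp add: normal_imp_completely_regular_space)
  then have "realcompact_universe X \<B> \<longleftrightarrow>
      (\<forall>\<F>. z_ultrafilter X \<F> \<longrightarrow> \<not> contains_unbounded_seq X \<B> \<F> \<longrightarrow> fixed_family \<F>)"
    using realcompact_imp_unbounded_free[OF _ assms(1) _ assms(3)]
      unbounded_free_imp_realcompact[OF _ assms(1,2)] by blast
  then show ?thesis unfolding contains_unbounded_seq_def .
qed

end
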